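(* Let $k$ be a finite field with $q$ elements, and let $m,n$ be integers with $0\le m\le (n+1)/2$. Let $\widehat{\chi}_{H_m}:V_n\to\mathbf{C}$ be the discrete Fourier transform of the characteristic function of $H_m\subseteq W_n$. Then for every $P\in V_n$, $$\widehat{\chi}_{H_m}(P)=q^m\left(\omega_m(P)-\omega_{m-1}(P)\right).$$
   Context: For an integer $n\ge -1$, $V_n$ is the $(n+1)$-dimensional $k$-vector space of homogeneous polynomials $P(Y,Z)=\sum_{i=0}^n a_iY^iZ^{n-i}$ of degree $n$ (including $0$) in $k[Y,Z]$, with $V_{-1}=\{0\}$. $W_n$ is the dual of $V_n$, identified with the space of sequences $x=(x_0,\ldots,x_n)\in k^{n+1}$ via the pairing $\langle P,x\rangle=\sum_{i=0}^n a_ix_i$. For $0\le 2m\le n+1$, $H_m\subseteq W_n$ is the set of sequences $(x_0,\ldots,x_n)$ for which there exist $a_0,\ldots,a_m\in k$, not all zero, such that $\sum_{i=0}^m a_ix_{i+j}=0$ for each $j=0,1,\ldots,n-m$. Its characteristic function $\chi_{H_m}:W_n\to\{0,1\}$ equals $1$ on $H_m$ and $0$ elsewhere. Fix a nontrivial homomorphism $\psi_0$ from the additive group of $k$ to the unit circle in $\mathbf{C}$. The discrete Fourier transform of $F:W_n\to\mathbf{C}$ is $\widehat F:V_n\to\mathbf{C}$, $\widehat F(P)=\sum_{x\in W_n}F(x)\psi_0(\langle P,x\rangle)$. For $P\in V_n$ and an integer $d$, $\omega_d(P)$ is $1/(q-1)$ times the number of nonzero homogeneous polynomials $Q$ of degree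 $d$ in $k[Y,Z]$ such that $P$ is a multiple of $Q$ in $k[Y,Z]$ (so $\omega_d(P)=0$ for $d<0$, and every nonzero $Q$ of degree $d\ge 0$ counts when $P=0$). *)

theory Defs
  imports
    Complex_Main
    "HOL-Library.FuncSet"
    "HOL-Library.Indicator_Function"
    "HOL-Library.Cardinality"
    "HOL-Computational_Algebra.Polynomial"
begin

text \<open>
  The ring \<open>k[Y,Z]\<close> is represented as \<open>k[Y][Z]\<close>, i.e. by the type \<^typ>\<open>'k poly poly\<close>:
  the inner variable is \<open>Y\<close>, the outer one is \<open>Z\<close>. The following is the coefficient
  of \<open>Y^i Z^j\<close>.
\<close>

definition coeff_YZ :: "'k::zero poly poly \<Rightarrow> nat \<Rightarrow> nat \<Rightarrow> 'k" where
  "coeff_YZ P i j = coeff (coeff P j) i"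

text \<open>Degrees are integers; for \<open>d < 0\<close> this leaves only the zero polynomial.\<close>

definition V :: "int \<Rightarrow> 'k::zero poly poly set" where
  "V d = {P. \<forall>i j. coeff_YZ P i j \<noteq> 0 \<longrightarrow> int i + int j = d}"

text \<open>
  Sequences \<open>(x\<^sub>0, \<dots>, x\<^sub>n)\<close> are extensional functions on the integer interval \<open>{0..n}\<close>,
  which is empty for \<open>n = -1\<close>, so that \<open>W (-1)\<close> is a singleton.
\<close>

definition W :: "int \<Rightarrow> (int \<Rightarrow> 'k) set" where
  "W n = ({0..n} \<rightarrow>\<^sub>E UNIV)"

definition pairing :: "int \<Rightarrow> 'k::comm_ring_1 poly poly \<Rightarrow> (int \<Rightarrow> 'k) \<Rightarrow> 'k" where
  "pairing n P x = (\<Sum>i\<in>{0..n}. coeff_YZ P (nat i) (nat (n - i)) * x i)"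

definition H :: "int \<Rightarrow> int \<Rightarrow> (int \<Rightarrow> 'k::comm_ring_1) set" where
  "H n m = {x \<in> W n. \<exists>a :: int \<Rightarrow> 'k. (\<exists>i\<in>{0..m}. a i \<noteq> 0) \<and>
                (\<forall>j\<in>{0..n - m}. (\<Sum>i\<in>{0..m}. a i * x (i + j)) = 0)}"

definition nontrivial_additive_character :: "('k::ab_group_add \<Rightarrow> complex) \<Rightarrow> bool" where
  "nontrivial_additive_character \<psi> \<longleftrightarrow>
     (\<forall>x. norm (\<psi> x) = 1) \<and> (\<forall>x y. \<psi> (x + y) = \<psi> x * \<psi> y) \<and> (\<exists>x. \<psi> x \<noteq> 1)"

definition fourier ::
  "('k::comm_ring_1 \<Rightarrow> complex) \<Rightarrow> int \<Rightarrow> ((int \<Rightarrow> 'k) \<Rightarrow> complex) \<Rightarrow> 'k poly poly \<Rightarrow> complex" where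
  "fourier \<psi> n F P = (\<Sum>x\<in>W n. F x * \<psi> (pairing n P x))"

definition omega :: "int \<Rightarrow> 'k::{finite,field} poly poly \<Rightarrow> real" where
  "omega d P = real (card {Q \<in> V d. Q \<noteq> 0 \<and> Q dvd P}) / (real CARD('k) - 1)"

end

theory Submission
  imports Defs
begin

text \<open>
  Let \<open>K\<^sub>i(x)\<close> be the space of forms \<open>Q\<close> of degree \<open>i\<close> such that \<open>x\<close> is orthogonal to all
  multiples of \<open>Q\<close> of degree \<open>n\<close>, so that \<open>x \<in> H\<^sub>m\<close> means \<open>K\<^sub>m(x) \<noteq> 0\<close>. For \<open>2 m \<le> n + 1\<close>, if
  \<open>K\<^sub>m(x) \<noteq> 0\<close> then \<open>|K\<^sub>m(x)| = q |K\<^bsub>m-1\<^esub>(x)|\<close>. Hence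
  \<open>(q - 1) \<chi>(x) = (|K\<^sub>m(x)| - 1) - q (|K\<^bsub>m-1\<^esub>(x)| - 1)\<close>, where \<open>\<chi>\<close> is the characteristic function
  of \<open>H\<^sub>m\<close>. The function \<open>|K\<^sub>d(x)| - 1\<close> is a sum over \<open>Q \<noteq> 0\<close> of characteristic functions of
  subspaces, whose Fourier transforms are \<open>q\<^sup>d\<close> times the characteristic functions of
  the multiples of \<open>Q\<close>; its transform is therefore \<open>q\<^sup>d (q - 1) \<omega>\<^sub>d\<close>.
\<close>

section \<open>Orthogonality of characters\<close>

lemma nontrivial_additive_character_zero:
  assumes "nontrivial_additive_character \<psi>"
  shows "\<psi> 0 = 1"
proof -
  have "\<psi> (0 + 0) = \<psi> 0 * \<psi> 0" and "norm (\<psi> 0) = 1"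
    using assms unfolding nontrivial_additive_character_def by blast+
  then show ?thesis by (auto simp: norm_eq_zero)
qed

lemma nontrivial_additive_character_sum:
  assumes "nontrivial_additive_character \<psi>"
  shows "\<psi> (sum f A) = (\<Prod>i\<in>A. \<psi> (f i))"
  using nontrivial_additive_character_zero[OF assms] assms
  by (induction A rule: infinite_finite_induct) (auto simp: nontrivial_additive_character_def)

text \<open>For \<open>y \<noteq> 0\<close>, translating \<open>t\<close> by \<open>s / y\<close>
  multiplies the sum by \<open>\<psi> s \<noteq> 1\<close>, so the sum vanishes.\<close>

lemma sum_character_scaled:
  fixes \<psi> :: "'k::{finite,field} \<Rightarrow> complex"
  assumes psi: "nontrivial_additive_character \<psi>"
  shows "(\<Sum>t\<in>UNIV. \<psi> (t * y)) = (if y = 0 then of_nat CARD('k) else 0)"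
proof (cases "y = 0")
  case True
  then show ?thesis using nontrivial_additive_character_zero[OF psi] by simp
next
  case False
  obtain s where s: "\<psi> s \<noteq> 1"
    using psi unfolding nontrivial_additive_character_def by blast
  have "bij_betw (\<lambda>t. t + s / y) UNIV (UNIV :: 'k set)"
    by (rule bij_betw_byWitness[where f' = "\<lambda>t. t - s / y"]) auto
  then have "(\<Sum>t\<in>UNIV. \<psi> (t * y)) = (\<Sum>t\<in>UNIV. \<psi> ((t + s / y) * y))"
    by (rule sum.reindex_bij_betw[symmetric])
  also have "\<dots> = (\<Sum>t\<in>UNIV. \<psi> (t * y) * \<psi> s)"
    using psi False by (intro sum.cong) (auto simp: nontrivial_additive_character_def distrib_right)
  also have "\<dots> = (\<Sum>t\<in>UNIV. \<psi> (t * y)) * \<psi> s"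
    by (simp add: sum_distrib_right)
  finally show ?thesis using s False by simp
qed

text \<open>The character turns the inner sum into a product, so the sum over \<open>W d\<close>
  factors into one-variable sums. For \<open>d < 0\<close> the interval is empty and both sides are
  \<open>1\<close>.\<close>

lemma sum_character_W:
  fixes \<psi> :: "'k::{finite,field} \<Rightarrow> complex"
  assumes psi: "nontrivial_additive_character \<psi>"
  shows "(\<Sum>b\<in>W d. \<psi> (\<Sum>j\<in>{0..d}. b j * y j))
           = (if \<forall>j\<in>{0..d}. y j = 0 then of_nat CARD('k) ^ nat (d + 1) else 0)"
proof -
  have "(\<Sum>b\<in>W d. \<psi> (\<Sum>j\<in>{0..d}. b j * y j)) = (\<Sum>b\<in>W d. \<Prod>j\<in>{0..d}. \<psi> (b j * y j))"
    by (simp add: nontrivial_additive_character_sum[OF psi])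
  also have "\<dots> = (\<Prod>j\<in>{0..d}. \<Sum>t\<in>UNIV. \<psi> (t * y j))"
    unfolding W_def by (rule prod_sum_PiE[symmetric]) auto
  also have "\<dots> = (\<Prod>j\<in>{0..d}. if y j = 0 then of_nat CARD('k) else 0)"
    by (simp add: sum_character_scaled[OF psi])
  also have "\<dots> = (if \<forall>j\<in>{0..d}. y j = 0 then of_nat CARD('k) ^ nat (d + 1) else 0)"
    by (cases "\<forall>j\<in>{0..d}. y j = 0") (auto intro!: prod_zero)
  finally show ?thesis .
qed

section \<open>Coefficient sequences of forms\<close>

text \<open>Unlike the extensional sequences in \<open>W d\<close>, these vanish outside
  \<open>{0..d}\<close>, so that sequences of different degrees are nested and index shifts stay
  meaningful.\<close>

definition Seq :: "int \<Rightarrow> (int \<Rightarrow> 'k::zero) set" where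
  "Seq d = {a. \<forall>i. a i \<noteq> 0 \<longrightarrow> 0 \<le> i \<and> i \<le> d}"

lemma Seq_mono: "d \<le> e \<Longrightarrow> Seq d \<subseteq> Seq e"
  by (force simp: Seq_def)

lemma zero_in_Seq [simp]: "(\<lambda>_. 0) \<in> Seq d"
  by (simp add: Seq_def)

lemma Seq_neg [simp]: "d < 0 \<Longrightarrow> Seq d = {\<lambda>_. 0}"
  by (fastforce simp: Seq_def)

lemma bij_betw_restrict_Seq_W: "bij_betw (\<lambda>b. restrict b {0..d}) (Seq d) (W d)"
  by (rule bij_betw_byWitness[where f' = "\<lambda>x i. if i \<in> {0..d} then x i else 0"])
     (auto simp: Seq_def W_def fun_eq_iff PiE_def extensional_def restrict_def split: if_splits)

lemma finite_W [simp]: "finite (W d :: (int \<Rightarrow> 'k::finite) set)"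
  unfolding W_def by (intro finite_PiE) auto

lemma finite_Seq [simp]: "finite (Seq d :: (int \<Rightarrow> 'k::{finite,zero}) set)"
  using bij_betw_finite[OF bij_betw_restrict_Seq_W[of d, where 'a = 'k]] by simp

lemma sum_character_Seq:
  fixes \<psi> :: "'k::{finite,field} \<Rightarrow> complex"
  assumes psi: "nontrivial_additive_character \<psi>"
  shows "(\<Sum>b\<in>Seq d. \<psi> (\<Sum>j\<in>{0..d}. b j * y j))
           = (if \<forall>j\<in>{0..d}. y j = 0 then of_nat CARD('k) ^ nat (d + 1) else 0)"
proof -
  have "(\<Sum>b\<in>Seq d. \<psi> (\<Sum>j\<in>{0..d}. b j * y j))
      = (\<Sum>b\<in>Seq d. \<psi> (\<Sum>j\<in>{0..d}. restrict b {0..d} j * y j))"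
    by simp
  also have "\<dots> = (\<Sum>b\<in>W d. \<psi> (\<Sum>j\<in>{0..d}. b j * y j))"
    by (rule sum.reindex_bij_betw[OF bij_betw_restrict_Seq_W])
  finally show ?thesis by (simp add: sum_character_W[OF psi])
qed

section \<open>Kernels of Hankel matrices\<close>

text \<open>This is \<open>K\<^sub>i(x)\<close> in coefficients: the left kernel of the Hankel
  matrix with entries \<open>x (l + j)\<close>. For \<open>i > n\<close> there are no equations and
  the kernel is all of \<open>Seq i\<close>.\<close>

definition hankel_ker :: "int \<Rightarrow> (int \<Rightarrow> 'k::comm_ring_1) \<Rightarrow> int \<Rightarrow> (int \<Rightarrow> 'k) set" where
  "hankel_ker n x i = {a \<in> Seq i. \<forall>j\<in>{0..n - i}. (\<Sum>l\<in>{0..i}. a l * x (l + j)) = 0}"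

lemma finite_hankel_ker [simp]: "finite (hankel_ker n x i :: (int \<Rightarrow> 'k::{finite,field}) set)"
  by (simp add: hankel_ker_def)

lemma zero_in_hankel_ker [simp]: "(\<lambda>_. 0) \<in> hankel_ker n x i"
  by (simp add: hankel_ker_def)

lemma hankel_ker_neg [simp]: "i < 0 \<Longrightarrow> hankel_ker n x i = {\<lambda>_. 0}"
  by (auto simp: hankel_ker_def)

lemma sum_Seq_extend:
  fixes a :: "int \<Rightarrow> 'k::comm_ring_1"
  assumes "a \<in> Seq d" "d \<le> e"
  shows "(\<Sum>l\<in>{0..e}. a l * x l) = (\<Sum>l\<in>{0..d}. a l * x l)"
  using assms by (intro sum.mono_neutral_right) (force simp: Seq_def)+

text \<open>Reading a sequence in one degree higher is multiplication by \<open>Z\<close>: a zero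
  top coefficient is added, and the equations required are among the old ones.\<close>

lemma hankel_ker_step:
  assumes "a \<in> hankel_ker n x (i - 1)"
  shows "a \<in> hankel_ker n x i"
proof -
  have a: "a \<in> Seq (i - 1)" using assms by (simp add: hankel_ker_def)
  have "(\<Sum>l\<in>{0..i}. a l * x (l + j)) = 0" if "j \<in> {0..n - i}" for j
    using sum_Seq_extend[OF a, of i "\<lambda>l. x (l + j)"] assms that by (simp add: hankel_ker_def)
  then show ?thesis using Seq_mono[of "i - 1" i] a by (auto simp: hankel_ker_def)
qed

text \<open>Shifting the sequence is multiplication by \<open>Y\<close>; it trades a step in
  \<open>l\<close> for a step in \<open>j\<close>.\<close>

lemma sum_shift_Seq:
  fixes a :: "int \<Rightarrow> 'k::comm_ring_1"
  assumes "a \<in> Seq (i - 1)"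
  shows "(\<Sum>l\<in>{0..i}. a (l - 1) * x (l + j)) = (\<Sum>l\<in>{0..i - 1}. a l * x (l + (j + 1)))"
proof -
  have "(\<Sum>l\<in>{0..i}. a (l - 1) * x (l + j)) = (\<Sum>l\<in>{1..i}. a (l - 1) * x (l + j))"
  proof (intro sum.mono_neutral_right ballI)
    fix l assume "l \<in> {0..i} - {1..i}"
    then have "a (l - 1) = 0" using assms by (fastforce simp: Seq_def)
    then show "a (l - 1) * x (l + j) = 0" by simp
  qed auto
  also have "\<dots> = (\<Sum>l\<in>{0..i - 1}. a l * x (l + (j + 1)))"
    by (rule sum.reindex_bij_witness[of _ "\<lambda>l. l + 1" "\<lambda>l. l - 1"]) (auto simp: algebra_simps)
  finally show ?thesis .
qed

lemma hankel_ker_shift_add: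
  assumes "a \<in> hankel_ker n x (i - 1)" "b \<in> hankel_ker n x (i - 1)"
  shows "(\<lambda>l. a (l - 1) + b l) \<in> hankel_ker n x i"
proof -
  have a: "a \<in> Seq (i - 1)" and b: "b \<in> Seq (i - 1)" using assms by (auto simp: hankel_ker_def)
  have "(\<Sum>l\<in>{0..i}. (a (l - 1) + b l) * x (l + j)) = 0" if "j \<in> {0..n - i}" for j
    using sum_Seq_extend[OF b, of i "\<lambda>l. x (l + j)"] sum_shift_Seq[OF a, of x j] assms that
    by (simp add: hankel_ker_def distrib_right sum.distrib)
  moreover have "(\<lambda>l. a (l - 1) + b l) \<in> Seq i"
    unfolding Seq_def
  proof (intro CollectI allI impI)
    fix l assume "a (l - 1) + b l \<noteq> 0"
    then have "a (l - 1) \<noteq> 0 \<or> b l \<noteq> 0" by auto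
    then show "0 \<le> l \<and> l \<le> i" using a b by (force simp: Seq_def)
  qed
  ultimately show ?thesis by (simp add: hankel_ker_def)
qed

lemma hankel_ker_diff:
  assumes "a \<in> hankel_ker n x i" "b \<in> hankel_ker n x i"
  shows "(\<lambda>l. a l - b l) \<in> hankel_ker n x i"
proof -
  have "(\<lambda>l. a l - b l) \<in> Seq i"
    using assms by (auto simp: hankel_ker_def Seq_def) (metis diff_0_right)+
  then show ?thesis
    using assms by (auto simp: hankel_ker_def left_diff_distrib sum_subtractf)
qed

lemma hankel_ker_scale:
  assumes "a \<in> hankel_ker n x i"
  shows "(\<lambda>l. t * a l) \<in> hankel_ker n x i"
  using assms by (auto simp: hankel_ker_def Seq_def mult.assoc simp flip: sum_distrib_left)
    (metis mult_zero_right)+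

text \<open>The shift stays in degree \<open>i - 1\<close> only if the top coefficient of
  \<open>d\<close> vanishes, so that \<open>d\<close> is \<open>Z\<close> times a form of degree
  \<open>i - 2\<close>. All equations for that form but the last come from \<open>d\<close>.\<close>

lemma hankel_ker_shift_both:
  assumes d: "d \<in> hankel_ker n x (i - 1)" and s: "(\<lambda>l. d (l - 1)) \<in> hankel_ker n x (i - 1)"
    and i: "i \<le> n + 1"
  shows "d \<in> hankel_ker n x (i - 2)"
proof -
  have "d \<in> Seq (i - 2)"
    unfolding Seq_def
  proof (intro CollectI allI impI)
    fix l assume "d l \<noteq> 0"
    then have "0 \<le> l" "l + 1 \<le> i - 1"
      using d s by (auto simp: hankel_ker_def Seq_def dest: spec[of _ "l + 1"])
    then show "0 \<le> l \<and> l \<le> i - 2" by simp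
  qed
  moreover have "(\<Sum>l\<in>{0..i - 2}. d l * x (l + j)) = 0" if j: "j \<in> {0..n - (i - 2)}" for j
  proof (cases "j \<le> n - (i - 1)")
    case True
    then show ?thesis
      using sum_Seq_extend[OF \<open>d \<in> Seq (i - 2)\<close>, of "i - 1" "\<lambda>l. x (l + j)"] d j
      by (simp add: hankel_ker_def)
  next
    \<comment> \<open>Here \<open>j = n - i + 2\<close>, and the equation is that of the shifted
      sequence at \<open>j - 1\<close>, where \<open>i \<le> n + 1\<close> ensures
      \<open>j - 1 \<ge> 0\<close>.\<close>
    case False
    then show ?thesis
      using sum_shift_Seq[of d "i - 1" x "j - 1"] \<open>d \<in> Seq (i - 2)\<close> s j i
      by (auto simp: hankel_ker_def)
  qed
  ultimately show ?thesis by (simp add: hankel_ker_def)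
qed

text \<open>
  In terms of polynomials, consider \<open>(A, B) \<mapsto> Y A + Z B\<close> on pairs of kernel elements of
  degree \<open>i - 1\<close>. Two pairs with the same image differ by \<open>(Z C, - Y C)\<close>, where \<open>C\<close> is a
  kernel element of degree \<open>i - 2\<close>.
\<close>

lemma card_hankel_ker_log_convex:
  fixes x :: "int \<Rightarrow> 'k::{finite,field}"
  assumes i: "i \<le> n + 1"
  shows "card (hankel_ker n x (i - 1)) ^ 2
           \<le> card (hankel_ker n x i) * card (hankel_ker n x (i - 2))"
proof -
  let ?K = "hankel_ker n x (i - 1)"
  define \<phi> :: "(int \<Rightarrow> 'k) \<times> (int \<Rightarrow> 'k) \<Rightarrow> int \<Rightarrow> 'k"
    where "\<phi> = (\<lambda>(a, b) l. a (l - 1) + b l)"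
  define F where "F c = {p \<in> ?K \<times> ?K. \<phi> p = c}" for c
  have fib: "card (F c) \<le> card (hankel_ker n x (i - 2))" for c
  proof (cases "F c = {}")
    case False
    then obtain a0 b0 where 0: "a0 \<in> ?K" "b0 \<in> ?K" "\<phi> (a0, b0) = c"
      by (auto simp: F_def)
    define g where "g = (\<lambda>(a, b :: int \<Rightarrow> 'k) l. a l - a0 l)"
    have shift: "a (l - 1) - a0 (l - 1) = b0 l - b l" if "(a, b) \<in> F c" for a b l
    proof -
      have "a (l - 1) + b l = a0 (l - 1) + b0 l"
        using that 0 by (auto simp: F_def \<phi>_def dest: fun_cong[of _ _ l])
      then show ?thesis by (simp add: algebra_simps)
    qed
    show ?thesis
    proof (rule card_inj_on_le[of g])
      show "inj_on g (F c)"
      proof (rule inj_onI, clarify)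
        fix a b a' b'
        assume F: "(a, b) \<in> F c" "(a', b') \<in> F c" and "g (a, b) = g (a', b')"
        then have "a l = a' l" for l by (auto simp: g_def dest: fun_cong[of _ _ l])
        then have "a = a'" by auto
        moreover have "b l = b' l" for l
          using shift[OF F(1), of l] shift[OF F(2), of l] \<open>a = a'\<close> by simp
        ultimately show "a = a' \<and> b = b'" by auto
      qed
      show "g ` F c \<subseteq> hankel_ker n x (i - 2)"
      proof clarify
        fix a b assume F: "(a, b) \<in> F c"
        then have K: "a \<in> ?K" "b \<in> ?K" by (auto simp: F_def)
        \<comment> \<open>The shift of \<open>a - a0\<close> is itself a difference of two kernel
          elements, as \<open>hankel_ker_shift_both\<close> requires.\<close>
        have "(\<lambda>l. a (l - 1) - a0 (l - 1)) = (\<lambda>l. b0 l - b l)"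
          using shift[OF F] by auto
        then show "g (a, b) \<in> hankel_ker n x (i - 2)"
          using hankel_ker_shift_both[OF hankel_ker_diff[OF K(1) 0(1)] _ i]
            hankel_ker_diff[OF 0(2) K(2)] by (simp add: g_def)
      qed
    qed simp
  qed simp
  have "?K \<times> ?K \<subseteq> (\<Union>c\<in>hankel_ker n x i. F c)"
    using hankel_ker_shift_add[of _ n x i] by (auto simp: F_def \<phi>_def)
  then have "card (?K \<times> ?K) \<le> card (\<Union>c\<in>hankel_ker n x i. F c)"
    by (rule card_mono[rotated]) (simp add: F_def)
  also have "\<dots> \<le> (\<Sum>c\<in>hankel_ker n x i. card (F c))"
    by (rule card_UN_le) simp
  also have "\<dots> \<le> card (hankel_ker n x i) * card (hankel_ker n x (i - 2))"
    using sum_bounded_above[OF fib] by simp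
  finally show ?thesis by (simp add: card_cartesian_product power2_eq_square)
qed

text \<open>The inner sums are the left-hand sides of the Hankel equations for \<open>a\<close>;
  orthogonality over \<open>b\<close> tests them all at once.\<close>

lemma sum_character_hankel:
  fixes \<psi> :: "'k::{finite,field} \<Rightarrow> complex"
  assumes psi: "nontrivial_additive_character \<psi>" and a: "a \<in> Seq m"
  shows "(\<Sum>b\<in>Seq (n - m). \<psi> (\<Sum>j\<in>{0..n - m}. b j * (\<Sum>l\<in>{0..m}. a l * x (l + j))))
           = (if a \<in> hankel_ker n x m then of_nat CARD('k) ^ nat (n - m + 1) else 0)"
  unfolding sum_character_Seq[OF psi] using a by (simp add: hankel_ker_def)

text \<open>Row rank equals column rank, obtained by evaluating a double character sum in both orders.\<close>

lemma card_hankel_ker_symmetry: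
  fixes \<psi> :: "'k::{finite,field} \<Rightarrow> complex" and x :: "int \<Rightarrow> 'k"
  assumes psi: "nontrivial_additive_character \<psi>"
  shows "CARD('k) ^ nat (n - m + 1) * card (hankel_ker n x m)
           = CARD('k) ^ nat (m + 1) * card (hankel_ker n x (n - m))"
proof -
  have *: "(\<Sum>a\<in>Seq m. \<Sum>b\<in>Seq (n - m).
              \<psi> (\<Sum>j\<in>{0..n - m}. b j * (\<Sum>l\<in>{0..m}. a l * x (l + j))))
            = of_nat (CARD('k) ^ nat (n - m + 1) * card (hankel_ker n x m))" for m
  proof -
    have "(\<Sum>a\<in>Seq m. \<Sum>b\<in>Seq (n - m).
              \<psi> (\<Sum>j\<in>{0..n - m}. b j * (\<Sum>l\<in>{0..m}. a l * x (l + j))))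
        = (\<Sum>a\<in>Seq m. if a \<in> hankel_ker n x m then of_nat CARD('k) ^ nat (n - m + 1) else 0)"
      by (intro sum.cong refl sum_character_hankel[OF psi])
    also have "\<dots> = (\<Sum>a\<in>hankel_ker n x m. of_nat CARD('k) ^ nat (n - m + 1))"
      by (rule sum.mono_neutral_cong_right) (auto simp: hankel_ker_def)
    finally show ?thesis by simp
  qed
  \<comment> \<open>Transposing the Hankel matrix for \<open>m\<close> gives the one for
    \<open>n - m\<close>, because its entries depend only on \<open>l + j\<close>.\<close>
  have "(\<Sum>j\<in>{0..n - m}. b j * (\<Sum>l\<in>{0..m}. a l * x (l + j)))
      = (\<Sum>l\<in>{0..m}. a l * (\<Sum>j\<in>{0..n - m}. b j * x (j + l)))" for a b :: "int \<Rightarrow> 'k"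
    unfolding sum_distrib_left by (subst sum.swap) (simp add: algebra_simps)
  then have "of_nat (CARD('k) ^ nat (n - m + 1) * card (hankel_ker n x m))
      = (\<Sum>a\<in>Seq m. \<Sum>b\<in>Seq (n - m).
           \<psi> (\<Sum>l\<in>{0..m}. a l * (\<Sum>j\<in>{0..n - m}. b j * x (j + l))))"
    by (simp only: *[symmetric])
  also have "\<dots> = (\<Sum>b\<in>Seq (n - m). \<Sum>a\<in>Seq m.
           \<psi> (\<Sum>l\<in>{0..m}. a l * (\<Sum>j\<in>{0..n - m}. b j * x (j + l))))"
    by (rule sum.swap)
  also have "\<dots> = of_nat (CARD('k) ^ nat (m + 1) * card (hankel_ker n x (n - m)))"
    using *[of "n - m"] by simp
  finally show ?thesis by (simp only: of_nat_eq_iff)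
qed

text \<open>The scalar multiples of a nonzero kernel element are \<open>q\<close> distinct kernel
  elements.\<close>

lemma card_hankel_ker_ge_CARD:
  fixes x :: "int \<Rightarrow> 'k::{finite,field}"
  assumes "card (hankel_ker n x i) \<noteq> 1"
  shows "CARD('k) \<le> card (hankel_ker n x i)"
proof -
  have "hankel_ker n x i \<noteq> {\<lambda>_. 0}" using assms by auto
  then obtain a l where a: "a \<in> hankel_ker n x i" "a l \<noteq> 0"
    using zero_in_hankel_ker[of n x i] by fastforce
  have "inj (\<lambda>t l. t * a l)"
    using a(2) by (auto intro!: injI dest: fun_cong[of _ _ l])
  moreover have "range (\<lambda>t l. t * a l) \<subseteq> hankel_ker n x i"
    using hankel_ker_scale[OF a(1)] by auto
  ultimately show ?thesis by (intro card_inj_on_le) auto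
qed

text \<open>
  The ratio of consecutive kernel sizes is nondecreasing in the degree \<open>i\<close> by log-convexity,
  and its values at \<open>i\<close> and \<open>n + 1 - i\<close> multiply to \<open>q^2\<close> by symmetry. So it is at most
  \<open>q\<close> for \<open>2 i \<le> n + 1\<close>, while it is at least \<open>q\<close> from the first nonzero kernel on.
\<close>

lemma card_hankel_ker_recurrence:
  fixes \<psi> :: "'k::{finite,field} \<Rightarrow> complex" and x :: "int \<Rightarrow> 'k"
  assumes psi: "nontrivial_additive_character \<psi>"
    and m: "0 \<le> m" "2 * m \<le> n + 1"
    and ne: "card (hankel_ker n x m) \<noteq> 1"
  shows "card (hankel_ker n x m) = CARD('k) * card (hankel_ker n x (m - 1))"
proof -
  define \<kappa> where "\<kappa> i = real (card (hankel_ker n x i))" for i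
  define \<rho> where "\<rho> i = \<kappa> i / \<kappa> (i - 1)" for i
  define q where "q = real CARD('k)"
  have q: "q > 0" by (simp add: q_def)
  have pos: "\<kappa> i > 0" for i
    using zero_in_hankel_ker[of n x i] by (auto simp: \<kappa>_def card_gt_0_iff simp del: zero_in_hankel_ker)
  have ratio_step: "\<rho> (i - 1) \<le> \<rho> i" if "i \<le> n + 1" for i
  proof -
    have "\<kappa> (i - 1) ^ 2 \<le> \<kappa> i * \<kappa> (i - 2)"
      using card_hankel_ker_log_convex[OF that, of x]
      by (simp add: \<kappa>_def flip: of_nat_power of_nat_mult)
    then show ?thesis
      using pos[of "i - 1"] pos[of "i - 2"]
      by (simp add: \<rho>_def field_simps power2_eq_square)
  qed
  have mono: "\<rho> i \<le> \<rho> j" if "i \<le> j" "j \<le> n + 1" for i j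
    using that
  proof (induction j rule: int_ge_induct)
    case (step j)
    then show ?case using ratio_step[of "j + 1"] by simp
  qed simp
  have sym: "q ^ nat (n - i + 1) * \<kappa> i = q ^ nat (i + 1) * \<kappa> (n - i)" for i
    using card_hankel_ker_symmetry[OF psi, of n i x]
    by (simp add: \<kappa>_def q_def flip: of_nat_power of_nat_mult)
  \<comment> \<open>\<open>A\<close> and \<open>B\<close> are the powers of \<open>q\<close> common
    to the symmetry at \<open>m - 1\<close> and at \<open>m\<close>; in each, one side carries a
    further factor \<open>q\<close>. No exponent truncates, since
    \<open>n - m + 1 \<ge> m \<ge> 0\<close>.\<close>
  define A B where "A = q ^ nat (n - m + 1)" and "B = q ^ nat m"
  have AB: "A > 0" "B > 0" using q by (simp_all add: A_def B_def)
  have shift: "n - (m - 1) = n + 1 - m" "m - 1 + 1 = m" by simp_all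
  have "nat (n + 1 - m + 1) = Suc (nat (n - m + 1))" using m by (simp add: nat_eq_iff)
  then have sym1: "A * (q * \<kappa> (m - 1)) = B * \<kappa> (n + 1 - m)"
    using sym[of "m - 1"] unfolding shift A_def B_def by (simp only: power_Suc2 mult.assoc)
  have "nat (m + 1) = Suc (nat m)" using m by (simp add: nat_eq_iff)
  then have sym2: "A * \<kappa> m = B * (q * \<kappa> (n - m))"
    using sym[of m] unfolding A_def B_def by (simp only: power_Suc2 mult.assoc)
  have "(A * B) * (\<kappa> (n + 1 - m) * \<kappa> m) = (B * \<kappa> (n + 1 - m)) * (A * \<kappa> m)"
    by (simp only: mult_ac)
  also have "\<dots> = (A * (q * \<kappa> (m - 1))) * (B * (q * \<kappa> (n - m)))"
    by (simp only: sym1 sym2)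
  also have "\<dots> = (A * B) * (q\<^sup>2 * (\<kappa> (m - 1) * \<kappa> (n - m)))"
    by (simp only: power2_eq_square mult_ac)
  finally have "\<kappa> (n + 1 - m) * \<kappa> m = q\<^sup>2 * (\<kappa> (n - m) * \<kappa> (m - 1))"
    using AB by (simp add: mult.commute)
  moreover have "n + 1 - m - 1 = n - m" by simp
  ultimately have rho: "\<rho> (n + 1 - m) * \<rho> m = q\<^sup>2"
    using pos[of "m - 1"] pos[of "n - m"] by (simp add: \<rho>_def)
  have "0 < \<rho> m"
    unfolding \<rho>_def by (intro divide_pos_pos pos)
  \<comment> \<open>By \<open>2 * m \<le> n + 1\<close>, \<open>m\<close> does not exceed its mirror
    index \<open>n + 1 - m\<close>, so \<open>\<rho> m\<close> is the smaller factor of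
    \<open>q\<^sup>2\<close>.\<close>
  moreover have "\<rho> m \<le> \<rho> (n + 1 - m)" using m by (intro mono) auto
  ultimately have "\<rho> m * \<rho> m \<le> \<rho> (n + 1 - m) * \<rho> m"
    by (rule mult_right_mono[OF _ less_imp_le, rotated])
  then have "(\<rho> m)\<^sup>2 \<le> q\<^sup>2" by (simp only: rho power2_eq_square)
  then have "\<rho> m \<le> q"
    by (rule power2_le_imp_le) (rule less_imp_le[OF q])
  \<comment> \<open>The induction starts at \<open>-1\<close>, where the kernel is trivial. After a
    trivial kernel, \<open>\<rho> (i + 1) = \<kappa> (i + 1)\<close>, which is \<open>1\<close> or
    at least \<open>q\<close>; from then on monotonicity keeps the bound.\<close>
  have dichotomy: "\<kappa> i = 1 \<or> q \<le> \<rho> i" if "-1 \<le> i" "i \<le> n + 1" for i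
    using that
  proof (induction i rule: int_ge_induct)
    case base
    then show ?case by (simp add: \<kappa>_def)
  next
    case (step i)
    then consider "\<kappa> i = 1" | "q \<le> \<rho> i" by auto
    then show ?case
    proof cases
      case 1
      then show ?thesis
        using card_hankel_ker_ge_CARD[of n x "i + 1"] by (auto simp: \<rho>_def \<kappa>_def q_def)
    next
      case 2
      then show ?thesis using step.prems mono[of i "i + 1"] by auto
    qed
  qed
  have "\<kappa> m \<noteq> 1" using ne by (simp add: \<kappa>_def)
  then have "q \<le> \<rho> m" using dichotomy[of m] m by linarith
  with \<open>\<rho> m \<le> q\<close> have "\<kappa> m = q * \<kappa> (m - 1)"
    using pos[of "m - 1"] by (simp add: \<rho>_def field_simps)
  then show ?thesis by (simp add: \<kappa>_def q_def flip: of_nat_mult)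
qed

section \<open>The characteristic function in terms of kernel sizes\<close>

text \<open>On \<open>H n m\<close> the recurrence makes the right-hand side \<open>q - 1\<close>;
  elsewhere both kernels are trivial and it is \<open>0\<close>.\<close>

lemma indicator_H_eq:
  fixes \<psi> :: "'k::{finite,field} \<Rightarrow> complex" and x :: "int \<Rightarrow> 'k"
  assumes psi: "nontrivial_additive_character \<psi>"
    and m: "0 \<le> m" "2 * m \<le> n + 1" and x: "x \<in> W n"
  shows "(of_nat CARD('k) - 1) * indicator (H n m) x
           = (of_nat (card (hankel_ker n x m - {\<lambda>_. 0}))
              - of_nat CARD('k) * of_nat (card (hankel_ker n x (m - 1) - {\<lambda>_. 0})) :: complex)"
proof -
  have H: "x \<in> H n m \<longleftrightarrow> hankel_ker n x m \<noteq> {\<lambda>_. 0}"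
  proof
    assume "x \<in> H n m"
    then obtain a i where a: "i \<in> {0..m}" "a i \<noteq> 0"
      "\<forall>j\<in>{0..n - m}. (\<Sum>i\<in>{0..m}. a i * x (i + j)) = 0"
      by (auto simp: H_def)
    \<comment> \<open>The witness from \<open>H\<close> is unconstrained outside
      \<open>{0..m}\<close>, so it is cut off to lie in \<open>Seq m\<close>.\<close>
    define a' where "a' i = (if i \<in> {0..m} then a i else 0)" for i
    have "(\<Sum>l\<in>{0..m}. a' l * x (l + j)) = (\<Sum>l\<in>{0..m}. a l * x (l + j))" for j
      by (rule sum.cong) (auto simp: a'_def)
    moreover have "a' \<in> Seq m" by (simp add: a'_def Seq_def)
    ultimately have "a' \<in> hankel_ker n x m" using a(3) by (simp add: hankel_ker_def)
    moreover have "a' i \<noteq> 0" using a by (simp add: a'_def)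
    ultimately show "hankel_ker n x m \<noteq> {\<lambda>_. 0}" by auto
  next
    assume "hankel_ker n x m \<noteq> {\<lambda>_. 0}"
    then obtain a i where "a \<in> hankel_ker n x m" "a i \<noteq> 0"
      using zero_in_hankel_ker[of n x m] by fastforce
    then have "i \<in> {0..m}" "\<forall>j\<in>{0..n - m}. (\<Sum>l\<in>{0..m}. a l * x (l + j)) = 0"
      by (auto simp: hankel_ker_def Seq_def)
    then show "x \<in> H n m" using x \<open>a i \<noteq> 0\<close> unfolding H_def by blast
  qed
  have card: "of_nat (card (hankel_ker n x i - {\<lambda>_. 0}))
      = (of_nat (card (hankel_ker n x i)) - 1 :: complex)" for i
  proof -
    have "card (insert (\<lambda>_. 0) (hankel_ker n x i - {\<lambda>_. 0}))
        = Suc (card (hankel_ker n x i - {\<lambda>_. 0}))"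
      by (rule card_insert_disjoint) auto
    then show ?thesis by (simp add: insert_absorb)
  qed
  show ?thesis
  proof (cases "card (hankel_ker n x m) = 1")
    case True
    then obtain z where "hankel_ker n x m = {z}" by (rule card_1_singletonE)
    moreover from this have "(\<lambda>_. 0) = z"
      using zero_in_hankel_ker[of n x m] by (simp only: singleton_iff)
    ultimately have "hankel_ker n x m = {\<lambda>_. 0}" by simp
    moreover from this have "hankel_ker n x (m - 1) = {\<lambda>_. 0}"
      using hankel_ker_step[of _ n x m] zero_in_hankel_ker[of n x "m - 1"] by blast
    ultimately show ?thesis using H by simp
  next
    case False
    then have "x \<in> H n m" using H by auto
    then show ?thesis
      unfolding card card_hankel_ker_recurrence[OF psi m False] by (simp add: algebra_simps)
  qed
qed

section \<open>Bivariate homogeneous polynomials\<close>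

definition form :: "int \<Rightarrow> (int \<Rightarrow> 'k::comm_ring_1) \<Rightarrow> 'k poly poly" where
  "form d a = (\<Sum>i\<in>{0..d}. monom (monom (a i) (nat i)) (nat (d - i)))"

lemma coeff_YZ_ext: "(\<And>i j. coeff_YZ P i j = coeff_YZ Q i j) \<Longrightarrow> P = Q"
  by (simp add: coeff_YZ_def poly_eq_iff)

lemma coeff_YZ_0 [simp]: "coeff_YZ 0 i j = 0"
  by (simp add: coeff_YZ_def)

lemma coeff_YZ_add [simp]: "coeff_YZ (P + Q) i j = coeff_YZ P i j + coeff_YZ Q i j"
  by (simp add: coeff_YZ_def)

lemma coeff_YZ_minus [simp]: "coeff_YZ (- P) i j = - coeff_YZ (P :: 'k::comm_ring_1 poly poly) i j"
  by (simp add: coeff_YZ_def)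

lemma coeff_YZ_sum: "coeff_YZ (sum f A) i j = (\<Sum>t\<in>A. coeff_YZ (f t) i j)"
  by (simp add: coeff_YZ_def coeff_sum)

lemma coeff_YZ_monom [simp]:
  "coeff_YZ (monom (monom c u) v) i j = (if u = i \<and> v = j then c else 0)"
  by (auto simp: coeff_YZ_def)

lemma coeff_YZ_mult:
  fixes P Q :: "'k::comm_ring_1 poly poly"
  shows "coeff_YZ (P * Q) i j
           = (\<Sum>v\<le>j. \<Sum>u\<le>i. coeff_YZ P u v * coeff_YZ Q (i - u) (j - v))"
  by (simp add: coeff_YZ_def coeff_mult coeff_sum)

lemma coeff_YZ_form:
  "coeff_YZ (form d a) i j = (if int i + int j = d then a (int i) else 0)"
proof -
  have "coeff_YZ (form d a) i j
      = (\<Sum>l\<in>{0..d}. if l = int i then (if int i + int j = d then a (int i) else 0) else 0)"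
    unfolding form_def coeff_YZ_sum
  proof (intro sum.cong refl)
    fix l assume "l \<in> {0..d}"
    then have "nat l = i \<and> nat (d - l) = j \<longleftrightarrow> l = int i \<and> int i + int j = d" by auto
    then show "coeff_YZ (monom (monom (a l) (nat l)) (nat (d - l))) i j
        = (if l = int i then (if int i + int j = d then a (int i) else 0) else 0)"
      by simp
  qed
  also have "\<dots> = (if int i + int j = d then a (int i) else 0)"
    by (subst sum.delta) auto
  finally show ?thesis .
qed

lemma form_in_V [simp]: "form d a \<in> V d"
  by (auto simp: V_def coeff_YZ_form)

lemma form_coeff_YZ:
  assumes "P \<in> V d"
  shows "form d (\<lambda>i. coeff_YZ P (nat i) (nat (d - i))) = P"
proof (rule coeff_YZ_ext)
  fix i j
  show "coeff_YZ (form d (\<lambda>i. coeff_YZ P (nat i) (nat (d - i)))) i j = coeff_YZ P i j"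
  proof (cases "int i + int j = d")
    case True
    then have "nat (d - int i) = j" by simp
    then show ?thesis using True by (simp add: coeff_YZ_form)
  next
    case False
    then have "coeff_YZ P i j = 0" using assms unfolding V_def by blast
    then show ?thesis using False by (simp add: coeff_YZ_form)
  qed
qed

lemma bij_betw_form: "bij_betw (form d) (Seq d) (V d :: 'k::comm_ring_1 poly poly set)"
proof (rule bij_betwI')
  fix a b :: "int \<Rightarrow> 'k" assume ab: "a \<in> Seq d" "b \<in> Seq d"
  have "a = b" if eq: "form d a = form d b"
  proof
    fix i
    show "a i = b i"
    proof (cases "0 \<le> i \<and> i \<le> d")
      case True
      then show ?thesis
        using arg_cong[OF eq, of "\<lambda>P. coeff_YZ P (nat i) (nat (d - i))"]
        by (simp add: coeff_YZ_form)
    next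
      case False
      then have "a i = 0" "b i = 0" using ab unfolding Seq_def by blast+
      then show ?thesis by simp
    qed
  qed
  then show "form d a = form d b \<longleftrightarrow> a = b" by auto
next
  fix P :: "'k poly poly" assume P: "P \<in> V d"
  let ?a = "\<lambda>i. if 0 \<le> i \<and> i \<le> d then coeff_YZ P (nat i) (nat (d - i)) else 0"
  have "?a \<in> Seq d" by (simp add: Seq_def)
  moreover have "form d ?a = form d (\<lambda>i. coeff_YZ P (nat i) (nat (d - i)))"
    unfolding form_def by (rule sum.cong) simp_all
  then have "P = form d ?a" by (simp only: form_coeff_YZ[OF P])
  ultimately show "\<exists>a\<in>Seq d. P = form d a" by blast
qed simp

lemma form_zero [simp]: "form d (\<lambda>_. 0) = 0"
  by (simp add: form_def)

lemma form_eq_0_iff: "a \<in> Seq d \<Longrightarrow> form d a = 0 \<longleftrightarrow> a = (\<lambda>_. 0)"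
  using inj_on_eq_iff[OF bij_betw_imp_inj_on[OF bij_betw_form[of d]], of a "\<lambda>_. 0"] by simp

text \<open>Any cofactor may be replaced by its homogeneous component of degree
  \<open>n - m\<close>, the \<open>?R\<close> below, since only that component contributes to the
  product in degree \<open>n\<close>.\<close>

lemma homogeneous_quotient:
  fixes P Q :: "'k::field poly poly"
  assumes Q: "Q \<in> V m" and P: "P \<in> V n" and dvd: "Q dvd P"
  obtains R where "R \<in> V (n - m)" "P = Q * R"
proof -
  obtain S where S: "P = Q * S" using dvd by (rule dvdE)
  let ?R = "form (n - m) (\<lambda>i. coeff_YZ S (nat i) (nat (n - m - i)))"
  have "coeff_YZ P i j = coeff_YZ (Q * ?R) i j" for i j
  proof -
    have "coeff_YZ Q u v * coeff_YZ ?R (i - u) (j - v)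
        = (if int i + int j = n then coeff_YZ Q u v * coeff_YZ S (i - u) (j - v) else 0)"
      if "u \<le> i" "v \<le> j" for u v
    proof (cases "coeff_YZ Q u v = 0")
      case False
      then have "int u + int v = m" using Q by (simp add: V_def)
      moreover from this have "nat (n - m - int (i - u)) = j - v" if "int i + int j = n"
        using that \<open>u \<le> i\<close> \<open>v \<le> j\<close> by auto
      moreover have "nat (int i - int u) = i - u" by arith
      ultimately show ?thesis using that by (auto simp: coeff_YZ_form of_nat_diff)
    qed simp
    then have "coeff_YZ (Q * ?R) i j = (if int i + int j = n then coeff_YZ (Q * S) i j else 0)"
      by (simp add: coeff_YZ_mult)
    moreover have "coeff_YZ P i j = 0" if "int i + int j \<noteq> n"
      using P that unfolding V_def by blast
    ultimately show ?thesis using S by simp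
  qed
  then have "P = Q * ?R" by (rule coeff_YZ_ext)
  then show thesis using that[of ?R] by simp
qed

lemma V_add:
  assumes "P \<in> V d" "Q \<in> V d"
  shows "P + Q \<in> V d"
  unfolding V_def
proof (intro CollectI allI impI)
  fix i j assume "coeff_YZ (P + Q) i j \<noteq> 0"
  then have "coeff_YZ P i j \<noteq> 0 \<or> coeff_YZ Q i j \<noteq> 0" by auto
  then show "int i + int j = d" using assms by (auto simp: V_def)
qed

lemma V_minus: "P \<in> V d \<Longrightarrow> - P \<in> V d" for P :: "'k::comm_ring_1 poly poly"
  by (auto simp: V_def)

lemma V_mult:
  fixes P Q :: "'k::comm_ring_1 poly poly"
  assumes "P \<in> V d" "Q \<in> V e"
  shows "P * Q \<in> V (d + e)"
proof -
  have "coeff_YZ (P * Q) i j = 0" if "int i + int j \<noteq> d + e" for i j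
    unfolding coeff_YZ_mult
  proof (intro sum.neutral ballI)
    fix v u assume uv: "v \<in> {..j}" "u \<in> {..i}"
    then have "int u + int v \<noteq> d \<or> int (i - u) + int (j - v) \<noteq> e"
      using that by (auto simp: of_nat_diff)
    then have "coeff_YZ P u v = 0 \<or> coeff_YZ Q (i - u) (j - v) = 0"
      using assms unfolding V_def by blast
    then show "coeff_YZ P u v * coeff_YZ Q (i - u) (j - v) = 0" by auto
  qed
  then show ?thesis unfolding V_def by blast
qed

section \<open>The pairing on products of forms\<close>

lemma pairing_add: "pairing n (P + Q) x = pairing n P x + pairing n Q x"
  by (simp add: pairing_def distrib_right sum.distrib)

lemma pairing_sum: "pairing n (sum f A) x = (\<Sum>t\<in>A. pairing n (f t) x)"
  unfolding pairing_def coeff_YZ_sum sum_distrib_right by (rule sum.swap)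

lemma pairing_monom:
  assumes "int u + int v = n"
  shows "pairing n (monom (monom c u) v) x = c * x (int u)"
proof -
  have "pairing n (monom (monom c u) v) x = (\<Sum>i\<in>{0..n}. if i = int u then c * x (int u) else 0)"
    unfolding pairing_def using assms by (intro sum.cong refl) auto
  then show ?thesis using assms by simp
qed

text \<open>Exponents of monomials add, so the pairing becomes the Hankel bilinear form of
  \<open>x\<close>. For \<open>a\<close> in \<open>Seq m\<close>, lying in the kernel thus means
  that \<open>x\<close> is orthogonal to all degree \<open>n\<close> multiples of
  \<open>form m a\<close>.\<close>

lemma pairing_form_mult:
  fixes x :: "int \<Rightarrow> 'k::comm_ring_1"
  shows "pairing n (form m a * form (n - m) b) x
           = (\<Sum>j\<in>{0..n - m}. b j * (\<Sum>l\<in>{0..m}. a l * x (l + j)))"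
proof -
  have "form m a * form (n - m) b
      = (\<Sum>l\<in>{0..m}. \<Sum>j\<in>{0..n - m}.
           monom (monom (a l * b j) (nat l + nat j)) (nat (m - l) + nat (n - m - j)))"
    by (simp add: form_def sum_product mult_monom)
  then have "pairing n (form m a * form (n - m) b) x
      = (\<Sum>l\<in>{0..m}. \<Sum>j\<in>{0..n - m}. a l * b j * x (l + j))"
    unfolding pairing_sum by (simp add: pairing_sum pairing_monom)
  also have "\<dots> = (\<Sum>j\<in>{0..n - m}. b j * (\<Sum>l\<in>{0..m}. a l * x (l + j)))"
    unfolding sum_distrib_left by (subst sum.swap) (simp add: mult_ac)
  finally show ?thesis .
qed

section \<open>Fourier transforms of kernel counts\<close>

lemma sum_character_pairing:
  fixes \<psi> :: "'k::{finite,field} \<Rightarrow> complex"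
  assumes psi: "nontrivial_additive_character \<psi>" and P: "P \<in> V n"
  shows "(\<Sum>x\<in>W n. \<psi> (pairing n P x)) = (if P = 0 then of_nat CARD('k) ^ nat (n + 1) else 0)"
proof -
  let ?c = "\<lambda>i. coeff_YZ P (nat i) (nat (n - i))"
  have "form n ?c = 0" if "\<forall>i\<in>{0..n}. ?c i = 0"
    unfolding form_def using that by simp
  then have "(\<forall>i\<in>{0..n}. ?c i = 0) \<longleftrightarrow> P = 0"
    using form_coeff_YZ[OF P] by auto
  then show ?thesis
    using sum_character_W[OF psi, where d = n and y = ?c] by (simp add: pairing_def mult.commute)
qed

text \<open>
  The kernel elements of degree \<open>m\<close> are those \<open>a\<close> for which \<open>x\<close> is orthogonal to all multiples
  of \<open>a\<close>; summing over \<open>x\<close> detects whether \<open>P\<close> is such a multiple.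
\<close>

lemma sum_character_kernel:
  fixes \<psi> :: "'k::{finite,field} \<Rightarrow> complex"
  assumes psi: "nontrivial_additive_character \<psi>"
    and m: "0 \<le> m" "m \<le> n + 1" and P: "P \<in> V n" and a: "a \<in> Seq m" "a \<noteq> (\<lambda>_. 0)"
  shows "(\<Sum>x\<in>W n. if a \<in> hankel_ker n x m then \<psi> (pairing n P x) else 0)
           = (if form m a dvd P then of_nat CARD('k) ^ nat m else 0)"
proof -
  let ?q = "of_nat CARD('k) :: complex"
  let ?A = "form m a"
  let ?B = "{b \<in> Seq (n - m). ?A * form (n - m) b = - P}"
  have A: "?A \<noteq> 0" using a by (simp add: form_eq_0_iff)
  have AB: "?A * form (n - m) b \<in> V n" for b
    using V_mult[of ?A m "form (n - m) b" "n - m"] by simp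
  \<comment> \<open>A nonzero form can be cancelled, so a cofactor is unique; a homogeneous one
    exists whenever \<open>?A\<close> divides \<open>P\<close>.\<close>
  have card: "card ?B = (if ?A dvd P then 1 else 0)"
  proof (cases "?A dvd P")
    case True
    then obtain R where R: "R \<in> V (n - m)" "- P = ?A * R"
      using homogeneous_quotient[of ?A m "- P" n] V_minus[OF P] by auto
    then obtain b where b: "b \<in> Seq (n - m)" "R = form (n - m) b"
      using bij_betw_imp_surj_on[OF bij_betw_form[of "n - m", where 'k = 'k]] by blast
    have "?B = {b}"
    proof (intro equalityI subsetI)
      fix c assume "c \<in> ?B"
      then have "c \<in> Seq (n - m)" "form (n - m) c = form (n - m) b" using R b A by auto
      then show "c \<in> {b}"
        using b(1) inj_onD[OF bij_betw_imp_inj_on[OF bij_betw_form]] by blast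
    qed (use R b in auto)
    then show ?thesis using True by simp
  next
    case False
    have "?A dvd P" if "b \<in> ?B" for b
    proof (rule dvdI)
      show "P = ?A * (- form (n - m) b)" using that by simp
    qed
    then have "?B = {}" using False by blast
    then have "card ?B = 0" by (simp only: card.empty)
    then show ?thesis using False by simp
  qed
  \<comment> \<open>The factor \<open>?q ^ nat (n - m + 1)\<close> lets the kernel condition be
    written as a character sum over \<open>b\<close>. After the swap, the sum over \<open>x\<close>
    leaves \<open>?q ^ nat (n + 1)\<close> for each \<open>b\<close> with
    \<open>?A * form (n - m) b + P = 0\<close>, hence the sign in \<open>?B\<close>.\<close>
  have "?q ^ nat (n - m + 1) * (\<Sum>x\<in>W n. if a \<in> hankel_ker n x m then \<psi> (pairing n P x) else 0)
      = (\<Sum>x\<in>W n. (if a \<in> hankel_ker n x m then ?q ^ nat (n - m + 1) else 0) * \<psi> (pairing n P x))"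
    by (simp add: sum_distrib_left if_distrib if_distribR cong: if_cong)
  also have "\<dots> = (\<Sum>x\<in>W n. \<Sum>b\<in>Seq (n - m). \<psi> (pairing n (?A * form (n - m) b + P) x))"
    unfolding sum_character_hankel[OF psi a(1), symmetric] sum_distrib_right
    using psi by (simp add: pairing_add pairing_form_mult nontrivial_additive_character_def)
  also have "\<dots> = (\<Sum>b\<in>Seq (n - m). \<Sum>x\<in>W n. \<psi> (pairing n (?A * form (n - m) b + P) x))"
    by (rule sum.swap)
  also have "\<dots> = (\<Sum>b\<in>Seq (n - m). if ?A * form (n - m) b = - P then ?q ^ nat (n + 1) else 0)"
    by (simp add: sum_character_pairing[OF psi V_add[OF AB P]] eq_neg_iff_add_eq_0)
  also have "\<dots> = (\<Sum>b\<in>?B. ?q ^ nat (n + 1))"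
    by (rule sum.mono_neutral_cong_right) auto
  also have "\<dots> = ?q ^ nat (n + 1) * (if ?A dvd P then 1 else 0)"
    using card by simp
  \<comment> \<open>Since \<open>0 \<le> m \<le> n + 1\<close>, neither exponent truncates;
    cancelling the common factor leaves \<open>?q ^ nat m\<close>.\<close>
  also have "?q ^ nat (n + 1) = ?q ^ nat (n - m + 1) * ?q ^ nat m"
    using m by (simp flip: power_add nat_add_distrib)
  finally show ?thesis by simp
qed

text \<open>The count is a sum of indicators over the nonzero \<open>a\<close> in
  \<open>Seq m\<close>. Each contributes \<open>q ^ nat m\<close> exactly when
  \<open>form m a\<close> divides \<open>P\<close>, and \<open>form m\<close> carries these
  \<open>a\<close> bijectively to the divisors counted by \<open>omega\<close>.\<close>

lemma fourier_card_hankel_ker: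
  fixes \<psi> :: "'k::{finite,field} \<Rightarrow> complex"
  assumes psi: "nontrivial_additive_character \<psi>"
    and m: "0 \<le> m" "m \<le> n + 1" and P: "P \<in> V n"
  shows "fourier \<psi> n (\<lambda>x. of_nat (card (hankel_ker n x m - {\<lambda>_. 0}))) P
           = of_nat CARD('k) ^ nat m * ((of_nat CARD('k) - 1) * of_real (omega m P))"
proof -
  let ?q = "of_nat CARD('k) :: complex"
  let ?S = "Seq m - {\<lambda>_. 0} :: (int \<Rightarrow> 'k) set"
  let ?D = "{Q \<in> V m. Q \<noteq> 0 \<and> Q dvd P}"
  have "fourier \<psi> n (\<lambda>x. of_nat (card (hankel_ker n x m - {\<lambda>_. 0}))) P
      = (\<Sum>x\<in>W n. \<Sum>a\<in>?S. if a \<in> hankel_ker n x m then \<psi> (pairing n P x) else 0)"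
    unfolding fourier_def
  proof (intro sum.cong refl)
    fix x
    have "of_nat (card (hankel_ker n x m - {\<lambda>_. 0})) * \<psi> (pairing n P x)
        = (\<Sum>a\<in>hankel_ker n x m - {\<lambda>_. 0}. \<psi> (pairing n P x))"
      by simp
    also have "\<dots> = (\<Sum>a\<in>?S. if a \<in> hankel_ker n x m then \<psi> (pairing n P x) else 0)"
      by (rule sum.mono_neutral_cong_left) (auto simp: hankel_ker_def)
    finally show "of_nat (card (hankel_ker n x m - {\<lambda>_. 0})) * \<psi> (pairing n P x)
        = (\<Sum>a\<in>?S. if a \<in> hankel_ker n x m then \<psi> (pairing n P x) else 0)" .
  qed
  also have "\<dots> = (\<Sum>a\<in>?S. if form m a dvd P then ?q ^ nat m else 0)"
    by (subst sum.swap) (intro sum.cong refl sum_character_kernel[OF psi m P], auto)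
  also have "\<dots> = (\<Sum>a\<in>{a \<in> ?S. form m a dvd P}. ?q ^ nat m)"
    by (rule sum.mono_neutral_cong_right) auto
  also have "\<dots> = ?q ^ nat m * of_nat (card {a \<in> ?S. form m a dvd P})"
    by simp
  also have "card {a \<in> ?S. form m a dvd P} = card ?D"
  proof (rule bij_betw_same_card)
    show "bij_betw (form m) {a \<in> ?S. form m a dvd P} ?D"
    proof (rule bij_betw_imageI)
      show "inj_on (form m) {a \<in> ?S. form m a dvd P}"
        by (rule inj_on_subset[OF bij_betw_imp_inj_on[OF bij_betw_form[of m]]]) auto
      show "form m ` {a \<in> ?S. form m a dvd P} = ?D"
      proof (intro equalityI subsetI)
        fix Q assume "Q \<in> form m ` {a \<in> ?S. form m a dvd P}"
        then obtain a where "a \<in> Seq m" "a \<noteq> (\<lambda>_. 0)" "form m a dvd P" "Q = form m a"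
          by auto
        then show "Q \<in> ?D" by (simp add: form_eq_0_iff)
      next
        fix Q assume Q: "Q \<in> ?D"
        then have "Q \<in> form m ` Seq m"
          by (simp add: bij_betw_imp_surj_on[OF bij_betw_form])
        then obtain a where a: "a \<in> Seq m" "Q = form m a" by (rule imageE)
        moreover have "a \<noteq> (\<lambda>_. 0)" using Q a(2) by auto
        ultimately show "Q \<in> form m ` {a \<in> ?S. form m a dvd P}" using Q by blast
      qed
    qed
  qed
  also have "of_nat (card ?D) = (?q - 1) * of_real (omega m P)"
  proof -
    \<comment> \<open>A field has at least two elements, so the division by \<open>q - 1\<close> in
      \<open>omega\<close> can be undone.\<close>
    have "card {0, 1 :: 'k} \<le> CARD('k)" by (rule card_mono) auto
    then have "real CARD('k) - 1 \<noteq> 0" by simp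
    then have "real (card ?D) = (real CARD('k) - 1) * omega m P" by (simp add: omega_def)
    then have "of_real (real (card ?D)) = (of_real ((real CARD('k) - 1) * omega m P) :: complex)"
      by (rule arg_cong)
    then show ?thesis by simp
  qed
  finally show ?thesis .
qed

lemma omega_neg: "d < 0 \<Longrightarrow> omega d P = 0" for P :: "'k::{finite,field} poly poly"
proof -
  assume "d < 0"
  then have "V d = {0 :: 'k poly poly}"
    using bij_betw_imp_surj_on[OF bij_betw_form[of d, where 'k = 'k]] by simp
  then show ?thesis by (simp add: omega_def)
qed

section \<open>The Fourier transform of the characteristic function\<close>

theorem theorem1:
  fixes \<psi> :: "'k::{finite,field} \<Rightarrow> complex"
    and m n :: int
    and P :: "'k poly poly"
  assumes "nontrivial_additive_character \<psi>"
    and "0 \<le> m"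
    and "2 * m \<le> n + 1"
    and "P \<in> V n"
  shows "fourier \<psi> n (indicator (H n m)) P
           = of_nat CARD('k) ^ nat m * of_real (omega m P - omega (m - 1) P)"
proof -
  let ?q = "of_nat CARD('k) :: complex"
  let ?N = "\<lambda>i x. of_nat (card (hankel_ker n x i - {\<lambda>_. 0})) :: complex"
  have "card {0, 1 :: 'k} \<le> CARD('k)" by (rule card_mono) auto
  then have "CARD('k) \<noteq> 1" by simp
  then have q: "?q - 1 \<noteq> 0" by (metis eq_iff_diff_eq_0 of_nat_eq_1_iff)
  \<comment> \<open>The extra \<open>?q\<close> lifts \<open>?q ^ nat (m - 1)\<close> to
    \<open>?q ^ nat m\<close>. For \<open>m = 0\<close> the exponent \<open>nat (m - 1)\<close>
    truncates, but the kernel count and \<open>omega\<close> both vanish in degree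
    \<open>-1\<close>.\<close>
  have "?q * fourier \<psi> n (?N (m - 1)) P
      = ?q ^ nat m * ((?q - 1) * of_real (omega (m - 1) P))"
  proof (cases "m = 0")
    case True
    then show ?thesis by (simp add: fourier_def omega_neg)
  next
    case False
    then have "nat m = Suc (nat (m - 1))" using assms(2) by simp
    moreover have "fourier \<psi> n (?N (m - 1)) P
        = ?q ^ nat (m - 1) * ((?q - 1) * of_real (omega (m - 1) P))"
      using assms False by (intro fourier_card_hankel_ker) auto
    ultimately show ?thesis by (simp only: power_Suc mult.assoc)
  qed
  moreover have "fourier \<psi> n (?N m) P = ?q ^ nat m * ((?q - 1) * of_real (omega m P))"
    using assms by (intro fourier_card_hankel_ker) auto
  moreover have "(?q - 1) * fourier \<psi> n (indicator (H n m)) P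
      = fourier \<psi> n (?N m) P - ?q * fourier \<psi> n (?N (m - 1)) P"
  proof -
    have "(?q - 1) * fourier \<psi> n (indicator (H n m)) P
        = (\<Sum>x\<in>W n. ((?q - 1) * indicator (H n m) x) * \<psi> (pairing n P x))"
      unfolding fourier_def sum_distrib_left by (simp only: mult.assoc)
    also have "\<dots> = (\<Sum>x\<in>W n. (?N m x - ?q * ?N (m - 1) x) * \<psi> (pairing n P x))"
      by (intro sum.cong refl) (simp only: indicator_H_eq[OF assms(1-3)])
    also have "\<dots> = fourier \<psi> n (?N m) P - ?q * fourier \<psi> n (?N (m - 1)) P"
      unfolding fourier_def left_diff_distrib sum_subtractf sum_distrib_left
      by (simp only: mult.assoc)
    finally show ?thesis .
  qed
  ultimately have "(?q - 1) * fourier \<psi> n (indicator (H n m)) P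
      = ?q ^ nat m * ((?q - 1) * of_real (omega m P))
        - ?q ^ nat m * ((?q - 1) * of_real (omega (m - 1) P))"
    by (simp only:)
  also have "\<dots> = (?q - 1) * (?q ^ nat m * of_real (omega m P - omega (m - 1) P))"
    by (simp add: algebra_simps)
  finally show ?thesis using q by simp
qed

end
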